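(* Denote by $\kappa'_n$ the representation of $\mathrm{K}_n$ with non-negative integer coefficients obtained from $\kappa_n$ via the evaluation $\xi_{i,j}\mapsto \mathrm{m}_j^{\,i}$ (the $i$-th power of $\mathrm{m}_j$), $1\leq i<j\leq n$. Then: (i) $\kappa'_n$ is faithful (i.e. injective as a map on $\mathrm{K}_n$). (ii) For every $w\in\mathrm{K}_n$ each entry of the matrix $\kappa'_n(w)$ is smaller than $\mathrm{l}_n$.
   Context: For a positive integer $n$, Kiselman's semigroup $\mathrm{K}_n$ is the monoid (with unit element $e$) given by the monoid presentation with generators $a_1,\dots,a_n$ and relations $a_i^2=a_i$ for $i=1,\dots,n$, and $a_ia_ja_i=a_ja_ia_j=a_ja_i$ for all $1\leq i<j\leq n$. The representation $\kappa_n$ is the monoid homomorphism from $\mathrm{K}_n$ to $n\times n$ matrices over the polynomial ring $\mathbb{Z}[\xi_{i,j}:1\leq i<j\leq n]$ which, for $i=1,\dots,n$, sends $a_{n-i+1}$ to the matrix obtained from the identity matrix by replacing the $i$-th column with $(\xi_{1,i},\xi_{2,i},\dots,\xi_{i-1,i},0,\dots,0)^t$ (so that the $i$-th row is zero and all columns other than the $i$-th are those of the identity matrix). The sequences $\mathrm{m}_i$ and $\mathrm{l}_i$, $i\geq 1$, are defined recursively by $\mathrm{m}_1=\mathrm{l}_1=1$ and, for $i\geq 2$, $\mathrm{m}_i=\mathrm{l}_{i-1}+1$ and $\mathrm{l}_i=i^{2^i}\,\mathrm{m}_i^{\,i2^i}$.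
   Formalization: Part (ii) is stated without the single case n = 1, w = e, where it fails: the matrix is (1) and l_1 = 1, so the entry 1 is not smaller than l_1. *)

theory Defs
  imports
    "HOL-Algebra.Group"
    "HOL-Library.Poly_Mapping"
    "Jordan_Normal_Form.Matrix"
begin

inductive_set pres_cong :: "'a set \<Rightarrow> ('a list \<times> 'a list) set \<Rightarrow> ('a list \<times> 'a list) set"
  for A :: "'a set" and R :: "('a list \<times> 'a list) set"
where
  rel: "(u, v) \<in> R \<Longrightarrow> u \<in> lists A \<Longrightarrow> v \<in> lists A \<Longrightarrow> (u, v) \<in> pres_cong A R"
| refl: "u \<in> lists A \<Longrightarrow> (u, u) \<in> pres_cong A R"
| sym: "(u, v) \<in> pres_cong A R \<Longrightarrow> (v, u) \<in> pres_cong A R"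
| trans: "(u, v) \<in> pres_cong A R \<Longrightarrow> (v, w) \<in> pres_cong A R \<Longrightarrow> (u, w) \<in> pres_cong A R"
| append: "(u, v) \<in> pres_cong A R \<Longrightarrow> (u', v') \<in> pres_cong A R \<Longrightarrow>
    (u @ u', v @ v') \<in> pres_cong A R"

definition pres_monoid :: "'a set \<Rightarrow> ('a list \<times> 'a list) set \<Rightarrow> 'a list set monoid" where
  "pres_monoid A R = \<lparr>
     carrier = lists A // pres_cong A R,
     monoid.mult = (\<lambda>X Y. \<Union>x\<in>X. \<Union>y\<in>Y. pres_cong A R `` {x @ y}),
     one = pres_cong A R `` {[]}\<rparr>"

lemma pres_cong_lists: "(u, v) \<in> pres_cong A R \<Longrightarrow> u \<in> lists A \<and> v \<in> lists A"
  by (induction rule: pres_cong.induct) auto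

lemma equiv_pres_cong: "equiv (lists A) (pres_cong A R)"
proof (rule equivI)
  show "pres_cong A R \<subseteq> lists A \<times> lists A"
    using pres_cong_lists by fast
  show "refl_on (lists A) (pres_cong A R)"
    by (simp add: refl_on_def pres_cong.refl)
  show "sym (pres_cong A R)" by (auto intro: symI pres_cong.sym)
  show "trans (pres_cong A R)" by (auto intro: transI pres_cong.trans)
qed

lemma pres_mult_class:
  assumes "u \<in> lists A" "v \<in> lists A"
  shows "(pres_cong A R `` {u}) \<otimes>\<^bsub>pres_monoid A R\<^esub> (pres_cong A R `` {v})
    = pres_cong A R `` {u @ v}"
proof -
  have *: "pres_cong A R `` {x @ y} = pres_cong A R `` {u @ v}"
    if "x \<in> pres_cong A R `` {u}" "y \<in> pres_cong A R `` {v}" for x y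
    using that by (auto intro!: equiv_class_eq[OF equiv_pres_cong, symmetric] pres_cong.append)
  have "u \<in> pres_cong A R `` {u}" "v \<in> pres_cong A R `` {v}"
    using assms by (auto intro: pres_cong.refl)
  then have "(\<Union>x\<in>pres_cong A R `` {u}. \<Union>y\<in>pres_cong A R `` {v}. pres_cong A R `` {x @ y})
      = pres_cong A R `` {u @ v}"
    using * by blast
  then show ?thesis by (simp add: pres_monoid_def)
qed

lemma monoid_pres_monoid: "Group.monoid (pres_monoid A R)"
proof (rule monoidI)
  have car: "\<exists>u\<in>lists A. X = pres_cong A R `` {u}" if "X \<in> carrier (pres_monoid A R)" for X
    using that by (auto simp: pres_monoid_def elim!: quotientE)
  have in_car: "pres_cong A R `` {u} \<in> carrier (pres_monoid A R)" if "u \<in> lists A" for u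
    using that by (auto simp: pres_monoid_def intro: quotientI)
  have one: "\<one>\<^bsub>pres_monoid A R\<^esub> = pres_cong A R `` {[]}"
    by (simp add: pres_monoid_def)
  note mult = pres_mult_class[of _ A _ R]
  show "\<one>\<^bsub>pres_monoid A R\<^esub> \<in> carrier (pres_monoid A R)"
    using in_car[of "[]"] one by simp
  fix X assume X: "X \<in> carrier (pres_monoid A R)"
  obtain x where x: "x \<in> lists A" "X = pres_cong A R `` {x}" using car[OF X] by blast
  show "\<one>\<^bsub>pres_monoid A R\<^esub> \<otimes>\<^bsub>pres_monoid A R\<^esub> X = X"
    using mult[of "[]" x] x by (simp add: one)
  show "X \<otimes>\<^bsub>pres_monoid A R\<^esub> \<one>\<^bsub>pres_monoid A R\<^esub> = X"
    using mult[of x "[]"] x by (simp add: one)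
  fix Y assume Y: "Y \<in> carrier (pres_monoid A R)"
  obtain y where y: "y \<in> lists A" "Y = pres_cong A R `` {y}" using car[OF Y] by blast
  have xy: "x @ y \<in> lists A" using x(1) y(1) by simp
  show "X \<otimes>\<^bsub>pres_monoid A R\<^esub> Y \<in> carrier (pres_monoid A R)"
    using mult[OF x(1) y(1)] in_car[OF xy] x(2) y(2) by simp
  fix Z assume Z: "Z \<in> carrier (pres_monoid A R)"
  obtain z where z: "z \<in> lists A" "Z = pres_cong A R `` {z}" using car[OF Z] by blast
  have yz: "y @ z \<in> lists A" using z(1) y(1) by simp
  show "X \<otimes>\<^bsub>pres_monoid A R\<^esub> Y \<otimes>\<^bsub>pres_monoid A R\<^esub> Z
      = X \<otimes>\<^bsub>pres_monoid A R\<^esub> (Y \<otimes>\<^bsub>pres_monoid A R\<^esub> Z)"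
    using mult[OF x(1) y(1)] mult[OF y(1) z(1)] mult[OF xy z(1)] mult[OF x(1) yz]
      x(2) y(2) z(2) by simp
qed


definition kiselman_rels :: "nat \<Rightarrow> (nat list \<times> nat list) set" where
  "kiselman_rels n =
     {([i, i], [i]) | i. i \<in> {1..n}} \<union>
     {([i, j, i], [j, i]) | i j. 1 \<le> i \<and> i < j \<and> j \<le> n} \<union>
     {([j, i, j], [j, i]) | i j. 1 \<le> i \<and> i < j \<and> j \<le> n}"

definition kiselman :: "nat \<Rightarrow> nat list set monoid" where
  "kiselman n = pres_monoid {1..n} (kiselman_rels n)"


text \<open>Integer polynomials in commuting variables indexed by pairs of naturals: a monomial is a
  finitely supported exponent function, a polynomial a finitely supported function from
  monomials to coefficients. Only the variables indexed by pairs \<open>(i, j)\<close> with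
  \<open>1 \<le> i < j \<le> n\<close> occur in the matrices below.\<close>

type_synonym xi_poly = "((nat \<times> nat) \<Rightarrow>\<^sub>0 nat) \<Rightarrow>\<^sub>0 int"

definition xi :: "nat \<Rightarrow> nat \<Rightarrow> xi_poly" where
  "xi i j = Poly_Mapping.single (Poly_Mapping.single (i, j) 1) 1"

text \<open>Matrix indices start at \<open>0\<close>, so the entry in row \<open>r\<close> and column \<open>c\<close> of the usual
  numbering has index \<open>(r - 1, c - 1)\<close>.\<close>

definition kappa_column_matrix :: "nat \<Rightarrow> nat \<Rightarrow> xi_poly mat" where
  "kappa_column_matrix n i = mat n n (\<lambda>(r, c).
     if c + 1 = i then (if r + 1 < i then xi (r + 1) i else 0)
     else if r = c then 1 else 0)"

definition kappa_gen :: "nat \<Rightarrow> nat \<Rightarrow> xi_poly mat" where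
  "kappa_gen n k = kappa_column_matrix n (n + 1 - k)"

definition kappa_word :: "nat \<Rightarrow> nat list \<Rightarrow> xi_poly mat" where
  "kappa_word n u = foldr (\<lambda>k M. kappa_gen n k * M) u (1\<^sub>m n)"

text \<open>Congruent words have the same matrix (\<open>kappa_word_cong\<close> below), so the set
  under \<open>the_elem\<close> is a singleton for every element of the semigroup.\<close>

definition kappa :: "nat \<Rightarrow> nat list set \<Rightarrow> xi_poly mat" where
  "kappa n w = the_elem (kappa_word n ` w)"

lemma kappa_column_matrix_carrier [simp]: "kappa_column_matrix n i \<in> carrier_mat n n"
  by (simp add: kappa_column_matrix_def)

lemma kappa_gen_carrier [simp]: "kappa_gen n k \<in> carrier_mat n n"
  by (simp add: kappa_gen_def)

lemma kappa_word_carrier [simp]: "kappa_word n u \<in> carrier_mat n n"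
  by (induction u) (auto simp: kappa_word_def intro: mult_carrier_mat[OF kappa_gen_carrier])

lemma kappa_word_append: "kappa_word n (u @ v) = kappa_word n u * kappa_word n v"
proof (induction u)
  case Nil
  then show ?case using left_mult_one_mat[OF kappa_word_carrier[of n v]]
    by (simp add: kappa_word_def)
next
  case (Cons k u)
  have "kappa_word n ((k # u) @ v) = kappa_gen n k * (kappa_word n u * kappa_word n v)"
    using Cons by (simp add: kappa_word_def)
  also have "\<dots> = kappa_gen n k * kappa_word n u * kappa_word n v"
    by (rule assoc_mult_mat[OF kappa_gen_carrier kappa_word_carrier kappa_word_carrier, symmetric])
  finally show ?case by (simp add: kappa_word_def)
qed

lemma kappa_column_matrix_mult_index:
  assumes A: "A \<in> carrier_mat n n" and p: "1 \<le> p" "p \<le> n" and r: "r < n" and c: "c < n"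
  shows "(kappa_column_matrix n p * A) $$ (r, c) =
    (if r + 1 = p then 0
     else A $$ (r, c) + (if r + 1 < p then xi (r + 1) p * A $$ (p - 1, c) else 0))"
proof -
  have "(kappa_column_matrix n p * A) $$ (r, c) =
      (\<Sum>k = 0..<n. kappa_column_matrix n p $$ (r, k) * A $$ (k, c))"
    using A r c by (simp add: scalar_prod_def kappa_column_matrix_def)
  also have "\<dots> = (\<Sum>k = 0..<n.
      (if k = r then (if r + 1 = p then 0 else A $$ (r, c)) else 0) +
      (if k = p - 1 then (if r + 1 < p then xi (r + 1) p * A $$ (p - 1, c) else 0) else 0))"
    using r p by (intro sum.cong) (auto simp: kappa_column_matrix_def)
  also have "\<dots> = (if r + 1 = p then 0
     else A $$ (r, c) + (if r + 1 < p then xi (r + 1) p * A $$ (p - 1, c) else 0))"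
    using r p by (simp add: sum.distrib)
  finally show ?thesis .
qed

lemma kappa_column_matrix_rels:
  assumes "1 \<le> p" "p < q" "q \<le> n"
  defines "P \<equiv> kappa_column_matrix n p" and "Q \<equiv> kappa_column_matrix n q"
  shows "Q * (P * Q) = P * Q" "P * (Q * P) = P * Q"
proof -
  have car: "P \<in> carrier_mat n n" "Q \<in> carrier_mat n n" "P * Q \<in> carrier_mat n n"
    "Q * P \<in> carrier_mat n n"
    by (auto simp: P_def Q_def intro: mult_carrier_mat[OF kappa_column_matrix_carrier])
  have Pi: "(P * A) $$ (r, c) = (if r + 1 = p then 0
     else A $$ (r, c) + (if r + 1 < p then xi (r + 1) p * A $$ (p - 1, c) else 0))"
    if "A \<in> carrier_mat n n" "r < n" "c < n" for A r c
    unfolding P_def using that assms(1-3) by (intro kappa_column_matrix_mult_index) auto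
  have Qi: "(Q * A) $$ (r, c) = (if r + 1 = q then 0
     else A $$ (r, c) + (if r + 1 < q then xi (r + 1) q * A $$ (q - 1, c) else 0))"
    if "A \<in> carrier_mat n n" "r < n" "c < n" for A r c
    unfolding Q_def using that assms(1-3) by (intro kappa_column_matrix_mult_index) auto
  have P0: "P $$ (r, c) = (if c + 1 = p then (if r + 1 < p then xi (r + 1) p else 0)
     else if r = c then 1 else 0)" if "r < n" "c < n" for r c
    using that by (simp add: P_def kappa_column_matrix_def)
  have Q0: "Q $$ (r, c) = (if c + 1 = q then (if r + 1 < q then xi (r + 1) q else 0)
     else if r = c then 1 else 0)" if "r < n" "c < n" for r c
    using that by (simp add: Q_def kappa_column_matrix_def)
  have bd: "p - 1 < n" "q - 1 < n" using assms by auto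
  obtain p' q' where pq: "p = Suc p'" "q = Suc q'"
    using assms(1,2) by (cases p; cases q) auto
  have PQ0: "(P * Q) $$ (q - 1, c) = 0" if "c < n" for c
    unfolding Pi[OF car(2) bd(2) that] Q0[OF bd(2) that] using assms(1-3) by auto
  show "Q * (P * Q) = P * Q"
  proof (rule eq_matI)
    fix r c assume "r < dim_row (P * Q)" "c < dim_col (P * Q)"
    then have rc: "r < n" "c < n" using car by auto
    show "(Q * (P * Q)) $$ (r, c) = (P * Q) $$ (r, c)"
      unfolding Qi[OF car(3) rc] PQ0[OF rc(2)]
      using PQ0[OF rc(2)] by (cases "r = q - 1") auto
  qed (use car in auto)
  have QP: "(Q * P) $$ (p - 1, c) = (if c + 1 = q then xi p q else 0)" if "c < n" for c
    unfolding Qi[OF car(1) bd(1) that] P0[OF bd(1) that] P0[OF bd(2) that] using assms(1-3) by auto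
  show "P * (Q * P) = P * Q"
  proof (rule eq_matI)
    fix r c assume "r < dim_row (P * Q)" "c < dim_col (P * Q)"
    then have rc: "r < n" "c < n" using car by auto
    show "(P * (Q * P)) $$ (r, c) = (P * Q) $$ (r, c)"
      unfolding Pi[OF car(4) rc] Pi[OF car(2) rc] Qi[OF car(1) rc] QP[OF rc(2)]
        P0[OF rc] P0[OF bd(2) rc(2)] Q0[OF rc] Q0[OF bd(1) rc(2)]
      using assms(2) pq by simp
  qed (use car in auto)
qed

lemma kappa_column_matrix_idem:
  assumes "1 \<le> p" "p \<le> n"
  shows "kappa_column_matrix n p * kappa_column_matrix n p = kappa_column_matrix n p"
proof (rule eq_matI)
  have bd: "p - 1 < n" using assms by auto
  have ix: "kappa_column_matrix n p $$ (r, c) = (if c + 1 = p then (if r + 1 < p then xi (r + 1) p else 0)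
     else if r = c then 1 else 0)" if "r < n" "c < n" for r c
    using that by (simp add: kappa_column_matrix_def)
  fix r c assume "r < dim_row (kappa_column_matrix n p)" "c < dim_col (kappa_column_matrix n p)"
  then have rc: "r < n" "c < n" by (auto simp: kappa_column_matrix_def)
  show "(kappa_column_matrix n p * kappa_column_matrix n p) $$ (r, c) =
      kappa_column_matrix n p $$ (r, c)"
    unfolding kappa_column_matrix_mult_index[OF kappa_column_matrix_carrier assms rc]
      ix[OF rc] ix[OF bd rc(2)]
    using assms(1) by (cases p) simp_all
qed (auto simp: kappa_column_matrix_def)

lemma kappa_word_rels:
  assumes "(u, v) \<in> kiselman_rels n"
  shows "kappa_word n u = kappa_word n v"
proof -
  note one = right_mult_one_mat[OF kappa_gen_carrier]
  consider i where "u = [i, i]" "v = [i]" "1 \<le> i" "i \<le> n"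
    | i j where "u = [i, j, i]" "v = [j, i]" "1 \<le> i" "i < j" "j \<le> n"
    | i j where "u = [j, i, j]" "v = [j, i]" "1 \<le> i" "i < j" "j \<le> n"
    using assms by (auto simp: kiselman_rels_def)
  then show ?thesis
  proof cases
    case 1
    then show ?thesis
      using kappa_column_matrix_idem[of "n + 1 - i" n] by (simp add: kappa_word_def one)
        (simp add: kappa_gen_def)
  next
    case 2
    then show ?thesis
      using kappa_column_matrix_rels(1)[of "n + 1 - j" "n + 1 - i" n]
      by (simp add: kappa_word_def one) (simp add: kappa_gen_def)
  next
    case 3
    then show ?thesis
      using kappa_column_matrix_rels(2)[of "n + 1 - j" "n + 1 - i" n]
      by (simp add: kappa_word_def one) (simp add: kappa_gen_def)
  qed
qed

lemma kappa_word_cong: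
  "(u, v) \<in> pres_cong {1..n} (kiselman_rels n) \<Longrightarrow> kappa_word n u = kappa_word n v"
  by (induction rule: pres_cong.induct) (auto simp: kappa_word_append intro: kappa_word_rels)

lemma kappa_class:
  assumes "u \<in> lists {1..n}"
  shows "kappa n (pres_cong {1..n} (kiselman_rels n) `` {u}) = kappa_word n u"
proof -
  have "kappa_word n ` (pres_cong {1..n} (kiselman_rels n) `` {u}) = {kappa_word n u}"
    using assms kappa_word_cong[of u _ n] by (auto intro!: image_eqI pres_cong.refl)
  then show ?thesis by (simp add: kappa_def)
qed

lemma kappa_hom: "kappa n \<in> hom (kiselman n) (ring_mat TYPE(xi_poly) n ())"
proof (rule homI)
  fix X assume "X \<in> carrier (kiselman n)"
  then obtain u where u: "u \<in> lists {1..n}" "X = pres_cong {1..n} (kiselman_rels n) `` {u}"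
    by (auto simp: kiselman_def pres_monoid_def elim!: quotientE)
  show "kappa n X \<in> carrier (ring_mat TYPE(xi_poly) n ())"
    using kappa_class[OF u(1)] u(2) by (simp add: ring_mat_simps)
  fix Y assume "Y \<in> carrier (kiselman n)"
  then obtain v where v: "v \<in> lists {1..n}" "Y = pres_cong {1..n} (kiselman_rels n) `` {v}"
    by (auto simp: kiselman_def pres_monoid_def elim!: quotientE)
  have uv: "u @ v \<in> lists {1..n}" using u v by simp
  show "kappa n (X \<otimes>\<^bsub>kiselman n\<^esub> Y) = kappa n X \<otimes>\<^bsub>ring_mat TYPE(xi_poly) n ()\<^esub> kappa n Y"
    using kappa_class[OF u(1)] kappa_class[OF v(1)] kappa_class[OF uv]
      pres_mult_class[OF u(1) v(1), of "kiselman_rels n"] u(2) v(2)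
    by (simp add: kiselman_def ring_mat_simps kappa_word_append)
qed

lemma kappa_one: "kappa n \<one>\<^bsub>kiselman n\<^esub> = 1\<^sub>m n"
  using kappa_class[of "[]" n] by (simp add: kiselman_def pres_monoid_def kappa_word_def)

lemma kappa_generator:
  assumes "1 \<le> i" "i \<le> n"
  shows "kappa n (pres_cong {1..n} (kiselman_rels n) `` {[n + 1 - i]}) = kappa_column_matrix n i"
proof -
  have "kappa_word n [n + 1 - i] = kappa_gen n (n + 1 - i)"
    using right_mult_one_mat[OF kappa_gen_carrier] by (simp add: kappa_word_def)
  moreover have "kappa_gen n (n + 1 - i) = kappa_column_matrix n i"
    using assms by (simp add: kappa_gen_def)
  ultimately show ?thesis using assms by (subst kappa_class) auto
qed


definition monom_eval :: "(nat \<times> nat \<Rightarrow> int) \<Rightarrow> ((nat \<times> nat) \<Rightarrow>\<^sub>0 nat) \<Rightarrow> int" where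
  "monom_eval x m = (\<Prod>v\<in>Poly_Mapping.keys m. x v ^ Poly_Mapping.lookup m v)"

definition poly_eval :: "(nat \<times> nat \<Rightarrow> int) \<Rightarrow> xi_poly \<Rightarrow> int" where
  "poly_eval x p = (\<Sum>m\<in>Poly_Mapping.keys p. Poly_Mapping.lookup p m * monom_eval x m)"

text \<open>The sequences are only meaningful from index \<open>1\<close> on; the values at \<open>0\<close> are
  placeholders.\<close>

fun m_seq :: "nat \<Rightarrow> nat" and l_seq :: "nat \<Rightarrow> nat" where
  "m_seq 0 = 1"
| "m_seq (Suc 0) = 1"
| "m_seq (Suc (Suc k)) = l_seq (Suc k) + 1"
| "l_seq 0 = 1"
| "l_seq (Suc 0) = 1"
| "l_seq (Suc (Suc k)) =
     (Suc (Suc k)) ^ (2 ^ (Suc (Suc k))) * m_seq (Suc (Suc k)) ^ (Suc (Suc k) * 2 ^ (Suc (Suc k)))"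

lemma m_seq_rec: "2 \<le> i \<Longrightarrow> m_seq i = l_seq (i - 1) + 1"
  by (cases i rule: m_seq.cases) auto

lemma l_seq_rec: "2 \<le> i \<Longrightarrow> l_seq i = i ^ (2 ^ i) * m_seq i ^ (i * 2 ^ i)"
  by (cases i rule: l_seq.cases) auto

definition kappa' :: "nat \<Rightarrow> nat list set \<Rightarrow> int mat" where
  "kappa' n w = map_mat (poly_eval (\<lambda>(i, j). int (m_seq j) ^ i)) (kappa n w)"

lemma monom_eval_superset:
  assumes "finite S" "Poly_Mapping.keys m \<subseteq> S"
  shows "monom_eval x m = (\<Prod>v\<in>S. x v ^ Poly_Mapping.lookup m v)"
  unfolding monom_eval_def using assms
  by (intro prod.mono_neutral_left) (auto simp: in_keys_iff)

lemma monom_eval_add: "monom_eval x (m + m') = monom_eval x m * monom_eval x m'"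
proof -
  let ?S = "Poly_Mapping.keys m \<union> Poly_Mapping.keys m'"
  have "monom_eval x (m + m') = (\<Prod>v\<in>?S. x v ^ Poly_Mapping.lookup (m + m') v)"
    using Poly_Mapping.keys_add[of m m'] by (intro monom_eval_superset) auto
  also have "\<dots> = (\<Prod>v\<in>?S. x v ^ Poly_Mapping.lookup m v) *
      (\<Prod>v\<in>?S. x v ^ Poly_Mapping.lookup m' v)"
    by (simp add: lookup_add power_add prod.distrib)
  also have "\<dots> = monom_eval x m * monom_eval x m'"
    by (simp add: monom_eval_superset[symmetric])
  finally show ?thesis .
qed

lemma poly_eval_superset:
  assumes "finite S" "Poly_Mapping.keys p \<subseteq> S"
  shows "poly_eval x p = (\<Sum>m\<in>S. Poly_Mapping.lookup p m * monom_eval x m)"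
  unfolding poly_eval_def using assms
  by (intro sum.mono_neutral_left) (auto simp: in_keys_iff)

lemma poly_eval_add: "poly_eval x (p + q) = poly_eval x p + poly_eval x q"
proof -
  let ?S = "Poly_Mapping.keys p \<union> Poly_Mapping.keys q"
  have "poly_eval x (p + q) = (\<Sum>m\<in>?S. Poly_Mapping.lookup (p + q) m * monom_eval x m)"
    using Poly_Mapping.keys_add[of p q] by (intro poly_eval_superset) auto
  also have "\<dots> = (\<Sum>m\<in>?S. Poly_Mapping.lookup p m * monom_eval x m) +
      (\<Sum>m\<in>?S. Poly_Mapping.lookup q m * monom_eval x m)"
    by (simp add: lookup_add distrib_right sum.distrib)
  also have "\<dots> = poly_eval x p + poly_eval x q"
    by (simp add: poly_eval_superset[symmetric])
  finally show ?thesis .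
qed

lemma poly_eval_0 [simp]: "poly_eval x 0 = 0"
  by (simp add: poly_eval_def)

lemma poly_eval_single [simp]: "poly_eval x (Poly_Mapping.single m a) = a * monom_eval x m"
  by (cases "a = 0") (simp_all add: poly_eval_def)

lemma poly_eval_1 [simp]: "poly_eval x 1 = 1"
  using poly_eval_single[of x 0 1] by (simp add: monom_eval_def del: poly_eval_single)

lemma poly_eval_xi: "poly_eval x (xi i j) = x (i, j)"
  by (simp add: xi_def monom_eval_def)

lemma xi_poly_induct [case_names single sum]:
  fixes p :: xi_poly
  assumes "\<And>m a. Q (Poly_Mapping.single m a)" "\<And>f g. Q f \<Longrightarrow> Q g \<Longrightarrow> Q (f + g)"
  shows "Q p"
proof (induction p rule: update_induct)
  case const
  show ?case using assms(1)[of 0 0] by simp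
next
  case (update f k v)
  have "Poly_Mapping.update k v f = f + Poly_Mapping.single k v"
    using update by (intro poly_mapping_eqI)
      (auto simp: lookup_update lookup_add lookup_single when_def in_keys_iff)
  then show ?case using update assms by simp
qed

lemma poly_eval_mult: "poly_eval x (p * q) = poly_eval x p * poly_eval x q"
proof (induction p rule: xi_poly_induct)
  case (single m a)
  show ?case
  proof (induction q rule: xi_poly_induct)
    case (single m' b)
    then show ?case by (simp add: mult_single monom_eval_add)
  next
    case (sum f g)
    then show ?case by (simp add: algebra_simps poly_eval_add)
  qed
next
  case (sum f g)
  then show ?case by (simp add: algebra_simps poly_eval_add)
qed

lemma kappa'_hom: "kappa' n \<in> hom (kiselman n) (ring_mat TYPE(int) n ())"
proof (rule homI)
  let ?e = "poly_eval (\<lambda>(i, j). int (m_seq j) ^ i)"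
  interpret e: semiring_hom ?e
    by unfold_locales (simp_all add: poly_eval_add poly_eval_mult)
  have car: "kappa n X \<in> carrier_mat n n" if "X \<in> carrier (kiselman n)" for X
    using hom_in_carrier[OF kappa_hom that] by (simp add: ring_mat_simps)
  fix X assume X: "X \<in> carrier (kiselman n)"
  show "kappa' n X \<in> carrier (ring_mat TYPE(int) n ())"
    using car[OF X] by (simp add: kappa'_def ring_mat_simps)
  fix Y assume Y: "Y \<in> carrier (kiselman n)"
  show "kappa' n (X \<otimes>\<^bsub>kiselman n\<^esub> Y) = kappa' n X \<otimes>\<^bsub>ring_mat TYPE(int) n ()\<^esub> kappa' n Y"
    using hom_mult[OF kappa_hom X Y] e.mat_hom_mult[OF car[OF X] car[OF Y]]
    by (simp add: kappa'_def ring_mat_simps)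
qed

lemma kappa'_one: "kappa' n \<one>\<^bsub>kiselman n\<^esub> = 1\<^sub>m n"
  by (rule eq_matI) (auto simp: kappa'_def kappa_one)

lemma kappa'_nonneg:
  assumes "w \<in> carrier (kiselman n)" "r < n" "c < n"
  shows "0 \<le> kappa' n w $$ (r, c)"
proof -
  let ?e = "poly_eval (\<lambda>(i, j). int (m_seq j) ^ i)"
  interpret e: semiring_hom ?e
    by unfold_locales (simp_all add: poly_eval_add poly_eval_mult)
  obtain u where u: "u \<in> lists {1..n}" "w = pres_cong {1..n} (kiselman_rels n) `` {u}"
    using assms(1) by (auto simp: kiselman_def pres_monoid_def elim!: quotientE)
  have gen: "0 \<le> ?e (kappa_gen n k $$ (r, c))" if "r < n" "c < n" for k r c
    using that by (auto simp: kappa_gen_def kappa_column_matrix_def poly_eval_xi)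
  have "0 \<le> ?e (kappa_word n u $$ (r, c))" if "r < n" "c < n" for r c
    using that
  proof (induction u arbitrary: r c)
    case Nil
    then show ?case by (simp add: kappa_word_def)
  next
    case (Cons k u)
    have "kappa_word n (k # u) $$ (r, c) =
        (\<Sum>i = 0..<n. kappa_gen n k $$ (r, i) * kappa_word n u $$ (i, c))"
      using Cons.prems carrier_matD[OF kappa_word_carrier[of n u]]
        carrier_matD[OF kappa_gen_carrier[of n k]]
      by (simp add: kappa_word_def scalar_prod_def)
    then show ?case
      using Cons gen by (auto simp: e.hom_sum poly_eval_mult intro!: sum_nonneg mult_nonneg_nonneg)
  qed
  then show ?thesis
    using assms kappa_class[OF u(1)] u(2) carrier_matD[OF kappa_word_carrier[of n u]]
    by (simp add: kappa'_def)
qed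

text \<open>For \<open>n = 1\<close> the unit element is mapped to the matrix \<open>(1)\<close>, whose entry is not smaller
  than \<open>l_seq 1 = 1\<close>. A strict bound by \<open>l_seq n\<close> therefore has to exclude this single case.\<close>

lemma kappa'_unit_degenerate: "kappa' 1 \<one>\<^bsub>kiselman 1\<^esub> $$ (0, 0) = int (l_seq 1)"
  by (simp add: kappa'_one)

end

theory Submission
  imports Defs "HOL-Library.Sublist"
begin

text \<open>Numbering the letters by the matrix columns, the entry \<open>(r, c)\<close> of \<open>\<kappa>\<^sub>n(u)\<close> is a sum of
  distinct monomials, one for each increasing chain \<open>r < s\<^sub>1 < \<dots> < s\<^sub>k = c\<close> such that
  \<open>s\<^sub>1 \<dots> s\<^sub>k\<close> is a subsequence of \<open>u\<close> and \<open>r s\<^sub>1 \<dots> s\<^sub>k\<close> is not. After the evaluation, grouping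
  the chains by their last step writes the entry in base \<open>m\<^sub>c\<close>; the sequences grow fast enough
  for the digits, which are sums over chains ending earlier, to be smaller than the base. So the
  entries determine these sets of chains, hence all increasing subsequences of \<open>u\<close>. Finally,
  every element of the semigroup has a representative in which any two occurrences of a letter
  are separated by both a larger and a smaller letter, and two such words with the same
  monotone subsequences are equal.\<close>

subsection \<open>Normal words\<close>

abbreviation kiselman_cong :: "nat \<Rightarrow> (nat list \<times> nat list) set" where
  "kiselman_cong n \<equiv> pres_cong {1..n} (kiselman_rels n)"

lemma kiselman_cong_append_left:
  assumes "(u, v) \<in> kiselman_cong n" "w \<in> lists {1..n}"
  shows "(w @ u, w @ v) \<in> kiselman_cong n"
  using assms by (intro pres_cong.append pres_cong.refl)

lemma kiselman_cong_append_right: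
  assumes "(u, v) \<in> kiselman_cong n" "w \<in> lists {1..n}"
  shows "(u @ w, v @ w) \<in> kiselman_cong n"
  using assms by (intro pres_cong.append pres_cong.refl)

lemma kiselman_cong_le:
  assumes "1 \<le> y" "y \<le> q" "q \<le> n"
  shows "([q, y, q], [q, y]) \<in> kiselman_cong n"
proof (cases "y = q")
  case True
  have "([q, q], [q]) \<in> kiselman_cong n"
    using assms by (intro pres_cong.rel) (auto simp: kiselman_rels_def)
  from kiselman_cong_append_left[OF this, of "[q]"] True assms show ?thesis by simp
next
  case False
  then show ?thesis
    using assms by (intro pres_cong.rel) (auto simp: kiselman_rels_def)
qed

lemma kiselman_cong_ge:
  assumes "1 \<le> q" "q \<le> y" "y \<le> n"
  shows "([q, y, q], [y, q]) \<in> kiselman_cong n"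
proof (cases "y = q")
  case True
  then show ?thesis using kiselman_cong_le[of q q n] assms by simp
next
  case False
  then show ?thesis
    using assms by (intro pres_cong.rel) (auto simp: kiselman_rels_def)
qed

text \<open>The induction peels letters off the right end of \<open>b\<close>. The induction
  hypothesis read backwards inserts a \<open>q\<close> in front of the last letter \<open>y\<close>,
  the relation turns \<open>q y q\<close> into \<open>q y\<close>, and the inserted \<open>q\<close>
  is removed again.\<close>

lemma kiselman_cong_drop_right:
  assumes "\<forall>x\<in>set b. 1 \<le> x \<and> x \<le> q" "1 \<le> q" "q \<le> n"
  shows "(q # b @ [q], q # b) \<in> kiselman_cong n"
  using assms(1)
proof (induction b rule: rev_induct)
  case Nil
  then show ?case
    using assms(2,3) by (auto intro!: pres_cong.rel simp: kiselman_rels_def)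
next
  case (snoc y b)
  have b: "b \<in> lists {1..n}" and y: "1 \<le> y" "y \<le> q"
    using snoc.prems assms by (auto simp: in_lists_conv_set)
  have IH: "(q # b @ [q], q # b) \<in> kiselman_cong n" using snoc by simp
  have "(q # b @ [y, q], q # b @ [q, y, q]) \<in> kiselman_cong n"
    using kiselman_cong_append_right[OF pres_cong.sym[OF IH], of "[y, q]"] y assms by simp
  moreover have "(q # b @ [q, y, q], q # b @ [q, y]) \<in> kiselman_cong n"
    using kiselman_cong_append_left[OF kiselman_cong_le[OF y assms(3)], of "q # b"] b assms by simp
  moreover have "(q # b @ [q, y], q # b @ [y]) \<in> kiselman_cong n"
    using kiselman_cong_append_right[OF IH, of "[y]"] y assms by simp
  ultimately show ?case using pres_cong.trans by (metis append_Cons append_assoc append_Nil)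
qed

text \<open>Mirror image of the previous argument: below larger letters it is the first copy of
  \<open>q\<close> that disappears, by way of \<open>q y q\<close> becoming
  \<open>y q\<close>.\<close>

lemma kiselman_cong_drop_left:
  assumes "\<forall>x\<in>set b. q \<le> x \<and> x \<le> n" "1 \<le> q" "q \<le> n"
  shows "(q # b @ [q], b @ [q]) \<in> kiselman_cong n"
  using assms(1)
proof (induction b)
  case Nil
  then show ?case
    using assms(2,3) by (auto intro!: pres_cong.rel simp: kiselman_rels_def)
next
  case (Cons y b)
  have b: "b \<in> lists {1..n}" and y: "q \<le> y" "y \<le> n"
    using Cons.prems assms by (auto simp: in_lists_conv_set)
  have IH: "(q # b @ [q], b @ [q]) \<in> kiselman_cong n" using Cons by simp
  have "(q # y # b @ [q], q # y # q # b @ [q]) \<in> kiselman_cong n"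
    using kiselman_cong_append_left[OF pres_cong.sym[OF IH], of "[q, y]"] y assms by simp
  moreover have "(q # y # q # b @ [q], y # q # b @ [q]) \<in> kiselman_cong n"
    using kiselman_cong_append_right[OF kiselman_cong_ge[OF assms(2) y], of "b @ [q]"] b assms
    by simp
  moreover have "(y # q # b @ [q], y # b @ [q]) \<in> kiselman_cong n"
    using kiselman_cong_append_left[OF IH, of "[y]"] y assms by simp
  ultimately show ?case using pres_cong.trans by (metis append_Cons append_assoc append_Nil)
qed

text \<open>A violation is exactly a factor \<open>q # b @ [q]\<close> in which all letters of
  \<open>b\<close> lie on one side of \<open>q\<close>, weakly, so that one of the two copies of
  \<open>q\<close> can be deleted.\<close>

definition normal_word :: "'a::linorder list \<Rightarrow> bool" where
  "normal_word u \<longleftrightarrow>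
     (\<forall>a q b c. u = a @ q # b @ q # c \<longrightarrow> (\<exists>x\<in>set b. x > q) \<and> (\<exists>x\<in>set b. x < q))"

text \<open>Each violation of normality allows a deletion that shortens the word, so deleting
  terminates.\<close>

lemma normal_word_exists:
  assumes "u \<in> lists {1..n}"
  shows "\<exists>v. (u, v) \<in> kiselman_cong n \<and> normal_word v"
  using assms
proof (induction u rule: length_induct)
  case (1 u)
  show ?case
  proof (cases "normal_word u")
    case True
    then show ?thesis using 1 by (auto intro: pres_cong.refl)
  next
    case False
    then obtain a q b c where u: "u = a @ q # b @ q # c"
      and "\<not> ((\<exists>x\<in>set b. x > q) \<and> (\<exists>x\<in>set b. x < q))"
      unfolding normal_word_def by blast
    then have b: "(\<forall>x\<in>set b. 1 \<le> x \<and> x \<le> q) \<or> (\<forall>x\<in>set b. q \<le> x \<and> x \<le> n)"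
      using 1(2) by (fastforce simp: in_lists_conv_set not_less)
    have q: "1 \<le> q" "q \<le> n" and ac: "a \<in> lists {1..n}" "c \<in> lists {1..n}"
      using 1(2) u by auto
    \<comment> \<open>Which copy of \<open>q\<close> goes depends on the case; only the loss of one
      letter matters afterwards.\<close>
    have "\<exists>d. (q # b @ [q], d) \<in> kiselman_cong n \<and> length d = Suc (length b)"
      using b
    proof
      assume "\<forall>x\<in>set b. 1 \<le> x \<and> x \<le> q"
      from kiselman_cong_drop_right[OF this q] show ?thesis by force
    next
      assume "\<forall>x\<in>set b. q \<le> x \<and> x \<le> n"
      from kiselman_cong_drop_left[OF this q] show ?thesis by force
    qed
    then obtain d where d: "(q # b @ [q], d) \<in> kiselman_cong n" "length d = Suc (length b)"
      by blast
    have *: "(u, a @ d @ c) \<in> kiselman_cong n"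
      using kiselman_cong_append_left[OF kiselman_cong_append_right[OF d(1) ac(2)] ac(1)] u by simp
    moreover have "a @ d @ c \<in> lists {1..n}" "length (a @ d @ c) < length u"
      using pres_cong_lists[OF *] d(2) u by auto
    ultimately obtain v where "(a @ d @ c, v) \<in> kiselman_cong n" "normal_word v"
      using 1(1) by blast
    then show ?thesis using * pres_cong.trans by blast
  qed
qed

section \<open>Decreasing subsequences separate normal words\<close>

lemma normal_word_appendD:
  assumes "normal_word (a @ b)"
  shows "normal_word a" "normal_word b"
proof -
  show "normal_word a"
    unfolding normal_word_def
  proof (intro allI impI)
    fix a1 q b1 c1 assume "a = a1 @ q # b1 @ q # c1"
    then have "a @ b = a1 @ q # b1 @ q # (c1 @ b)" by simp
    then show "(\<exists>x\<in>set b1. x > q) \<and> (\<exists>x\<in>set b1. x < q)"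
      using assms unfolding normal_word_def by blast
  qed
  show "normal_word b"
    unfolding normal_word_def
  proof (intro allI impI)
    fix a1 q b1 c1 assume "b = a1 @ q # b1 @ q # c1"
    then have "a @ b = (a @ a1) @ q # b1 @ q # c1" by simp
    then show "(\<exists>x\<in>set b1. x > q) \<and> (\<exists>x\<in>set b1. x < q)"
      using assms unfolding normal_word_def by blast
  qed
qed

text \<open>If an embedding placed this \<open>q\<close> inside \<open>a\<close>, then
  \<open>d @ [q]\<close> would embed into \<open>a\<close>; hence \<open>q\<close> and all that
  follows it land in \<open>b\<close>.\<close>

lemma subseq_after_prefix:
  assumes "subseq (d @ q # y) (a @ b)" "\<not> subseq (d @ [q]) a"
  shows "subseq (q # y) b"
proof -
  obtain s t where st: "d @ q # y = s @ t" "subseq s a" "subseq t b"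
    using assms(1) by (auto simp: subseq_append_iff)
  consider us where "us @ q # y = t" | us where "d @ [q] @ us = s"
    using st(1) by (auto simp: append_eq_append_conv2 Cons_eq_append_conv)
  then show ?thesis
  proof cases
    case 1
    then show ?thesis using st(3) subseq_order.trans[of "q # y" t b] by auto
  next
    case (2 us)
    then have "subseq (d @ [q]) s" by (metis append.assoc prefixI prefix_imp_subseq)
    then show ?thesis using st(2) assms(2) subseq_order.trans by blast
  qed
qed

lemma subseq_before_suffix:
  assumes "subseq (x @ q # e) (a @ b)" "\<not> subseq (q # e) b"
  shows "subseq (x @ [q]) a"
proof -
  obtain s t where st: "x @ q # e = s @ t" "subseq s a" "subseq t b"
    using assms(1) by (auto simp: subseq_append_iff)
  consider us where "us @ q # e = t" | us where "x @ [q] @ us = s"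
    using st(1) by (auto simp: append_eq_append_conv2 Cons_eq_append_conv)
  then show ?thesis
  proof cases
    case 1
    then show ?thesis using st(3) assms(2) subseq_order.trans[of "q # e" t b] by auto
  next
    case (2 us)
    then have "subseq (x @ [q]) s" by (metis append.assoc prefixI prefix_imp_subseq)
    then show ?thesis using st(2) subseq_order.trans by blast
  qed
qed

lemma subseq_set_subset: "subseq x u \<Longrightarrow> set x \<subseteq> set u"
  by (auto dest: list_emb_set)

text \<open>If \<open>q\<close> occurs in \<open>a\<close>, a letter \<open>t > q\<close> follows its last occurrence. A witness for that
  occurrence of \<open>t\<close>, extended by \<open>t\<close>, is a witness for \<open>q\<close>: its leftmost embedding
  ends at this \<open>t\<close>, after which there is no \<open>q\<close> left in \<open>a\<close>.\<close>

lemma normal_word_front_witness: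
  assumes "normal_word (a @ [q])"
  shows "\<exists>d. sorted_wrt (>) (d @ [q]) \<and> subseq d a \<and> \<not> subseq (d @ [q]) a"
  using assms
proof (induction a arbitrary: q rule: length_induct)
  case (1 a)
  show ?case
  proof (cases "q \<in> set a")
    case False
    then show ?thesis by (intro exI[of _ "[]"]) (auto simp: subseq_singleton_left)
  next
    case True
    then obtain a1 a2 where a: "a = a1 @ q # a2" "q \<notin> set a2"
      by (meson split_list_last)
    have "a @ [q] = a1 @ q # a2 @ q # []" using a by simp
    then obtain t where t: "t \<in> set a2" "t > q"
      using 1(2) unfolding normal_word_def by blast
    then obtain b1 b2 where b: "a2 = b1 @ t # b2" by (meson split_list)
    define p where "p = a1 @ q # b1"
    have ap: "a = (p @ [t]) @ b2" using a b p_def by simp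
    have "normal_word (p @ [t])"
      using 1(2) normal_word_appendD(1)[of "p @ [t]" "b2 @ [q]"] by (simp add: ap)
    moreover have "length p < length a" by (simp add: ap)
    ultimately obtain d where d: "sorted_wrt (>) (d @ [t])" "subseq d p" "\<not> subseq (d @ [t]) p"
      using 1(1) by blast
    have "subseq (d @ [t]) a"
      unfolding ap using d(2) by (intro subseq_rev_drop_many list_emb_append_mono) auto
    moreover have "\<not> subseq (d @ [t, q]) a"
    proof
      assume "subseq (d @ [t, q]) a"
      then have "subseq [t, q] (t # b2)"
        using subseq_after_prefix[of d t "[q]" p "t # b2"] d(3) ap by simp
      then have "q \<in> set (t # b2)" using subseq_set_subset by fastforce
      then show False using a(2) b t by auto
    qed
    moreover have "sorted_wrt (>) (d @ [t, q])"
      using d(1) t(2) by (auto simp: sorted_wrt_append)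
    ultimately show ?thesis by (intro exI[of _ "d @ [t]"]) simp
  qed
qed

text \<open>Dual to the front witness: if \<open>q\<close> occurs in \<open>b\<close>, some
  \<open>t < q\<close> precedes its first occurrence there. A witness \<open>e\<close> for that
  \<open>t\<close> yields \<open>t # e\<close>, whose rightmost embedding starts at this
  \<open>t\<close>, with no \<open>q\<close> before it.\<close>

lemma normal_word_back_witness:
  assumes "normal_word (q # b)"
  shows "\<exists>e. sorted_wrt (>) (q # e) \<and> subseq e b \<and> \<not> subseq (q # e) b"
  using assms
proof (induction b arbitrary: q rule: length_induct)
  case (1 b)
  show ?case
  proof (cases "q \<in> set b")
    case False
    then show ?thesis by (intro exI[of _ "[]"]) (auto simp: subseq_singleton_left)
  next
    case True
    then obtain b1 b2 where b: "b = b1 @ q # b2" "q \<notin> set b1"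
      by (meson split_list_first)
    have "q # b = [] @ q # b1 @ q # b2" using b by simp
    then obtain t where t: "t \<in> set b1" "t < q"
      using 1(2) unfolding normal_word_def by blast
    then obtain c1 c2 where c: "b1 = c1 @ t # c2" by (meson split_list)
    define p where "p = c2 @ q # b2"
    have bp: "b = c1 @ t # p" using b c p_def by simp
    have "normal_word (t # p)"
      using 1(2) normal_word_appendD(2)[of "q # c1" "t # p"] by (simp add: bp)
    moreover have "length p < length b" by (simp add: bp)
    ultimately obtain e where e: "sorted_wrt (>) (t # e)" "subseq e p" "\<not> subseq (t # e) p"
      using 1(1) by blast
    have "subseq (t # e) b"
      using e(2) unfolding bp by (intro list_emb_append2) auto
    moreover have "\<not> subseq (q # t # e) b"
    proof
      assume "subseq (q # t # e) b"
      then have "subseq [q, t] (c1 @ [t])"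
        using subseq_before_suffix[of "[q]" t e "c1 @ [t]" p] e(3) bp by simp
      then have "q \<in> set (c1 @ [t])" using subseq_set_subset by fastforce
      then show False using b(2) c t by auto
    qed
    moreover have "sorted_wrt (>) (q # t # e)"
      using e(1) t(2) by auto
    ultimately show ?thesis by (intro exI[of _ "t # e"]) simp
  qed
qed

text \<open>Handles words of which one is a proper prefix of the other; the front witness for the
  first extra letter separates them.\<close>

lemma normal_word_prefix_not_same:
  assumes "normal_word (w @ x # u)"
  shows "\<exists>d. sorted_wrt (>) d \<and> subseq d (w @ x # u) \<and> \<not> subseq d w"
proof -
  have "normal_word (w @ [x])"
    using normal_word_appendD(1)[of "w @ [x]" u] assms by simp
  then obtain d where d: "sorted_wrt (>) (d @ [x])" "subseq d w" "\<not> subseq (d @ [x]) w"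
    using normal_word_front_witness by blast
  have "subseq (d @ [x]) (w @ x # u)"
    using d(2) by (intro list_emb_append_mono) auto
  then show ?thesis using d by blast
qed

text \<open>With \<open>d\<close> a front witness for \<open>x\<close> and \<open>e\<close> a back witness for \<open>y\<close>, the sequence
  \<open>d x y e\<close> embeds into the first word but not into the second one, where the embedding would
  have to place \<open>y e\<close> behind the \<open>y\<close> following \<open>w\<close>.\<close>

lemma normal_word_first_difference:
  assumes "normal_word (w @ x # u)" "normal_word (w @ y # v)" "x > y"
  shows "\<exists>z. sorted_wrt (>) z \<and> (subseq z (w @ x # u) \<longleftrightarrow> \<not> subseq z (w @ y # v))"
proof (rule ccontr)
  assume "\<not> ?thesis"
  then have same: "subseq z (w @ x # u) \<longleftrightarrow> subseq z (w @ y # v)" if "sorted_wrt (>) z" for z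
    using that by blast
  have "normal_word (w @ [x])" "normal_word (w @ [y])" "normal_word (y # v)"
    using normal_word_appendD(1)[of "w @ [x]" u] normal_word_appendD(1)[of "w @ [y]" v]
      normal_word_appendD(2)[of w "y # v"] assms by simp_all
  note normal = this
  obtain d where d: "sorted_wrt (>) (d @ [x])" "subseq d w" "\<not> subseq (d @ [x]) w"
    using normal_word_front_witness[OF normal(1)] by blast
  obtain g where g: "sorted_wrt (>) (g @ [y])" "subseq g w" "\<not> subseq (g @ [y]) w"
    using normal_word_front_witness[OF normal(2)] by blast
  obtain e where e: "sorted_wrt (>) (y # e)" "subseq e v" "\<not> subseq (y # e) v"
    using normal_word_back_witness[OF normal(3)] by blast
  \<comment> \<open>The front witness \<open>g\<close> serves only to transfer \<open>y # e\<close>: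
    since \<open>g @ [y]\<close> does not fit into \<open>w\<close>, this tail must embed behind
    \<open>w\<close> in the first word too, and past its leading \<open>x\<close>.\<close>
  have "subseq (g @ y # e) (w @ y # v)"
    using g(2) e(2) by (intro list_emb_append_mono) auto
  moreover have "sorted_wrt (>) (g @ y # e)"
    using g(1) e(1) by (fastforce simp: sorted_wrt_append)
  ultimately have "subseq (g @ y # e) (w @ x # u)" using same by simp
  then have "subseq (y # e) (x # u)" using g(3) by (rule subseq_after_prefix)
  from subseq_Cons2_neq[OF this] have "subseq (y # e) u" using assms(3) by auto
  then have "subseq (d @ x # y # e) (w @ x # u)"
    using d(2) by (intro list_emb_append_mono) auto
  moreover have "sorted_wrt (>) (d @ x # y # e)"
    using d(1) e(1) assms(3) by (fastforce simp: sorted_wrt_append)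
  ultimately have "subseq (d @ x # y # e) (w @ y # v)" using same by simp
  then have "subseq (x # y # e) (y # v)" using d(3) by (rule subseq_after_prefix)
  from subseq_Cons2_neq[OF this] have "subseq (x # y # e) v" using assms(3) by auto
  then have "subseq (y # e) v" by (rule subseq_Cons')
  with e(3) show False ..
qed

lemma normal_word_eqI:
  assumes "normal_word u" "normal_word v"
    and "\<And>z. sorted_wrt (>) z \<Longrightarrow> subseq z u \<longleftrightarrow> subseq z v"
  shows "u = v"
proof -
  \<comment> \<open>The common prefix \<open>w\<close> grows during the induction, because the
    hypothesis on subsequences speaks of the whole words only.\<close>
  have "u' = v'" if "u = w @ u'" "v = w @ v'" for w u' v'
    using that
  proof (induction u' arbitrary: w v')
    case Nil
    then show ?case
      using normal_word_prefix_not_same[of w] assms by (cases v') auto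
  next
    case (Cons x u')
    show ?case
    proof (cases v')
      case Nil
      then show ?thesis
        using normal_word_prefix_not_same[of w x u'] assms Cons.prems by auto
    next
      case v': (Cons y v'')
      have "\<not> x < y" "\<not> y < x"
        using normal_word_first_difference[of w y v'' x u'] assms
          normal_word_first_difference[of w x u' y v''] Cons.prems v' by auto
      then have "x = y" by simp
      then show ?thesis using Cons.IH[of "w @ [x]" v''] Cons.prems v' by simp
    qed
  qed
  from this[of "[]"] show ?thesis by simp
qed


subsection \<open>Increasing chains and their weights\<close>

text \<open>The start \<open>r\<close> stays outside the list, since only the later indices must be
  read off the word; \<open>[]\<close> is the chain from \<open>r\<close> to itself.\<close>

definition asc_chains :: "nat \<Rightarrow> nat \<Rightarrow> nat list set" where
  "asc_chains r c = {x. sorted_wrt (<) (r # x) \<and> last (r # x) = c}"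

definition fresh_chains :: "nat list \<Rightarrow> nat \<Rightarrow> nat \<Rightarrow> nat list set" where
  "fresh_chains u r c = {x \<in> asc_chains r c. subseq x u \<and> \<not> subseq (r # x) u}"

text \<open>Chains consist of \<open>0\<close>-based indices, hence the shifts by one with respect to
  \<open>\<xi>\<^sub>i\<^sub>,\<^sub>j \<mapsto> m\<^sub>j\<^sup>i\<close>.\<close>

fun chain_weight :: "nat list \<Rightarrow> nat" where
  "chain_weight (r # s # x) = m_seq (Suc s) ^ Suc r * chain_weight (s # x)"
| "chain_weight x = 1"

lemma chain_weight_snoc:
  "x \<noteq> [] \<Longrightarrow> chain_weight (x @ [c]) = chain_weight x * m_seq (Suc c) ^ Suc (last x)"
  by (induction x rule: chain_weight.induct) auto

lemma asc_chains_self: "asc_chains r r = {[]}"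
proof -
  have "x = []" if "sorted_wrt (<) (r # x)" "last (r # x) = r" for x
    using that by (cases x rule: rev_cases) auto
  then show ?thesis by (auto simp: asc_chains_def)
qed

lemma asc_chains_greater: "c < r \<Longrightarrow> asc_chains r c = {}"
  using last_in_set by (fastforce simp: asc_chains_def split: if_splits)

lemma snoc_in_asc_chains:
  assumes "y \<in> asc_chains r s" "s < c"
  shows "y @ [c] \<in> asc_chains r c"
proof -
  have y: "sorted_wrt (<) (r # y)" and s: "last (r # y) = s"
    using assms(1) by (auto simp: asc_chains_def)
  have "a \<le> s" if "a \<in> set (r # y)" for a
  proof -
    have "r # y = butlast (r # y) @ [s]"
      using s append_butlast_last_id[of "r # y"] by simp
    then have "sorted_wrt (<) (butlast (r # y) @ [s])" "set (r # y) = insert s (set (butlast (r # y)))"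
      using y by (metis, metis Un_insert_right list.simps(15) set_append sup_bot.right_neutral empty_set)
    then show ?thesis using that by (auto simp: sorted_wrt_append simp del: butlast.simps)
  qed
  then have "sorted_wrt (<) ((r # y) @ [c])"
    using y assms(2) unfolding sorted_wrt_append by fastforce
  then show ?thesis by (simp add: asc_chains_def)
qed

lemma asc_chains_snocE:
  assumes "x \<in> asc_chains r c" "r \<noteq> c"
  obtains s y where "s < c" "y \<in> asc_chains r s" "x = y @ [c]"
proof -
  have x: "sorted_wrt (<) (r # x)" "last (r # x) = c" using assms by (auto simp: asc_chains_def)
  with assms(2) have "x \<noteq> []" by auto
  then obtain y where y: "x = y @ [c]"
    using x(2) by (metis append_butlast_last_id last_ConsR)
  have *: "sorted_wrt (<) ((r # y) @ [c])" using x(1) y by simp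
  have "last (r # y) \<in> set (r # y)" by (rule last_in_set) simp
  then have "last (r # y) < c"
    using * unfolding sorted_wrt_append by auto
  moreover have "y \<in> asc_chains r (last (r # y))"
    using * unfolding sorted_wrt_append by (simp add: asc_chains_def)
  ultimately show ?thesis using that y by blast
qed

lemma asc_chains_decompose:
  assumes "r \<noteq> c"
  shows "asc_chains r c = (\<Union>s<c. (\<lambda>y. y @ [c]) ` asc_chains r s)"
proof (intro equalityI subsetI)
  fix x assume "x \<in> asc_chains r c"
  then obtain s y where "s < c" "y \<in> asc_chains r s" "x = y @ [c]"
    using assms by (rule asc_chains_snocE)
  then show "x \<in> (\<Union>s<c. (\<lambda>y. y @ [c]) ` asc_chains r s)" by blast
qed (auto intro: snoc_in_asc_chains)

lemma finite_asc_chains: "finite (asc_chains r c)"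
proof (induction c rule: less_induct)
  case (less c)
  show ?case
  proof (cases "r = c")
    case False
    show ?thesis unfolding asc_chains_decompose[OF False] using less by blast
  qed (simp add: asc_chains_self)
qed

lemma asc_chains_disjoint: "s \<noteq> t \<Longrightarrow> asc_chains r s \<inter> asc_chains r t = {}"
  by (auto simp: asc_chains_def)

text \<open>The step from \<open>s\<close> to \<open>c\<close> contributes
  \<open>m_seq (Suc c) ^ Suc s\<close>. After one common factor is pulled out, a numeral in base
  \<open>m_seq (Suc c)\<close> remains, whose digit at \<open>s\<close> is the weight of the
  truncated chains ending in \<open>s\<close>.\<close>

lemma sum_chain_weight_last_step:
  assumes "r \<noteq> c" "A \<subseteq> asc_chains r c"
  shows "(\<Sum>x\<in>A. chain_weight (r # x)) =
    m_seq (Suc c) *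
      (\<Sum>s<c. (\<Sum>y | y \<in> asc_chains r s \<and> y @ [c] \<in> A. chain_weight (r # y)) * m_seq (Suc c) ^ s)"
proof -
  define B where "B s = {y. y \<in> asc_chains r s \<and> y @ [c] \<in> A}" for s
  have A: "A = (\<Union>s<c. (\<lambda>y. y @ [c]) ` B s)"
    using assms(2) unfolding B_def asc_chains_decompose[OF assms(1)] by blast
  have fin: "finite (B s)" for s
    using finite_asc_chains[of r s] by (rule finite_subset[rotated]) (auto simp: B_def)
  have disj: "(\<lambda>y. y @ [c]) ` B s \<inter> (\<lambda>y. y @ [c]) ` B t = {}" if "s \<noteq> t" for s t
    using asc_chains_disjoint[OF that, of r] by (auto simp: B_def)
  have "(\<Sum>x\<in>A. chain_weight (r # x)) =
      (\<Sum>s<c. \<Sum>x\<in>(\<lambda>y. y @ [c]) ` B s. chain_weight (r # x))"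
    unfolding A by (rule sum.UNION_disjoint) (use fin disj in auto)
  also have "\<dots> = (\<Sum>s<c. \<Sum>y\<in>B s. chain_weight (r # y) * m_seq (Suc c) ^ Suc s)"
  proof (rule sum.cong[OF HOL.refl])
    fix s
    have "chain_weight (r # y @ [c]) = chain_weight (r # y) * m_seq (Suc c) ^ Suc s"
      if "y \<in> B s" for y
      using chain_weight_snoc[of "r # y" c] that unfolding B_def asc_chains_def by auto
    then show "(\<Sum>x\<in>(\<lambda>y. y @ [c]) ` B s. chain_weight (r # x)) =
        (\<Sum>y\<in>B s. chain_weight (r # y) * m_seq (Suc c) ^ Suc s)"
      by (subst sum.reindex) (auto simp: inj_on_def)
  qed
  also have "\<dots> = m_seq (Suc c) * (\<Sum>s<c. (\<Sum>y\<in>B s. chain_weight (r # y)) * m_seq (Suc c) ^ s)"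
    by (simp add: sum_distrib_left sum_distrib_right mult_ac)
  finally show ?thesis unfolding B_def .
qed

section \<open>Expansions in a fixed base\<close>

lemma digits_bound:
  fixes a :: "nat \<Rightarrow> nat"
  assumes "\<And>s. s < c \<Longrightarrow> a s < B"
  shows "(\<Sum>s<c. a s * B ^ s) < B ^ c"
  using assms
proof (induction c)
  case (Suc c)
  then have "(\<Sum>s<c. a s * B ^ s) < B ^ c" "Suc (a c) \<le> B" by (auto simp: Suc_le_eq)
  then have "(\<Sum>s<c. a s * B ^ s) + a c * B ^ c < Suc (a c) * B ^ c" by simp
  also have "\<dots> \<le> B * B ^ c" using \<open>Suc (a c) \<le> B\<close> by (rule mult_right_mono) simp
  finally show ?case by simp
qed simp

text \<open>Division by \<open>B ^ c\<close> isolates the top digit, as the lower part is smaller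
  than \<open>B ^ c\<close>; cancelling it leaves the shorter expansions.\<close>

lemma digits_unique:
  fixes a b :: "nat \<Rightarrow> nat"
  assumes "\<And>s. s < c \<Longrightarrow> a s < B" "\<And>s. s < c \<Longrightarrow> b s < B"
    and "(\<Sum>s<c. a s * B ^ s) = (\<Sum>s<c. b s * B ^ s)" "s < c"
  shows "a s = b s"
  using assms
proof (induction c)
  case (Suc c)
  have lt: "(\<Sum>s<c. a s * B ^ s) < B ^ c" "(\<Sum>s<c. b s * B ^ s) < B ^ c"
    using Suc.prems by (auto intro: digits_bound)
  have eq: "a c * B ^ c + (\<Sum>s<c. a s * B ^ s) = b c * B ^ c + (\<Sum>s<c. b s * B ^ s)"
    using Suc.prems(3) by (simp add: add.commute)
  have "a c = (a c * B ^ c + (\<Sum>s<c. a s * B ^ s)) div B ^ c"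
    using lt(1) by (subst div_mult_self3) (auto dest: gr_implies_not0)
  also have "\<dots> = b c"
    unfolding eq using lt(2) by (subst div_mult_self3) (auto dest: gr_implies_not0)
  finally have c: "a c = b c" .
  then show ?case using Suc eq by (cases "s = c") auto
qed simp

section \<open>Growth of the sequences and bounds on weight sums\<close>

lemma m_seq_Suc: "1 \<le> i \<Longrightarrow> m_seq (Suc i) = Suc (l_seq i)"
  by (cases i) auto

lemma l_seq_pos: "0 < l_seq i"
  by (cases i rule: l_seq.cases) (auto simp: m_seq_Suc)

lemma m_seq_power_le_l_seq:
  assumes "2 \<le> i"
  shows "m_seq i ^ i \<le> l_seq i"
proof -
  have "0 < m_seq i" using assms by (simp add: m_seq_rec)
  then have "m_seq i ^ i \<le> m_seq i ^ (i * 2 ^ i)" by (intro power_increasing) auto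
  also have "\<dots> \<le> l_seq i" using assms by (simp add: l_seq_rec)
  finally show ?thesis .
qed

lemma l_seq_less_m_seq:
  assumes "i \<le> j" "1 \<le> i"
  shows "l_seq i < m_seq (Suc j)"
  using assms(1)
proof (induction j rule: dec_induct)
  case base
  then show ?case using assms by (simp add: m_seq_Suc)
next
  case (step j)
  have "m_seq (Suc j) \<le> m_seq (Suc j) ^ Suc j" by (rule self_le_power) (use step in auto)
  also have "\<dots> \<le> l_seq (Suc j)" using step assms by (intro m_seq_power_le_l_seq) auto
  finally show ?case using step by simp
qed

text \<open>For \<open>r \<noteq> c\<close> the digits are below the base
  \<open>m_seq (Suc c)\<close>, so the sum is below its power with exponent \<open>Suc c\<close>. At
  \<open>c = 0\<close> strictness fails: for \<open>r = 0\<close> the empty chain has weight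
  \<open>1 = l_seq 1\<close>.\<close>

lemma sum_chain_weight_strict:
  assumes "0 < c"
    and le: "\<And>s. s < c \<Longrightarrow> (\<Sum>x\<in>asc_chains r s. chain_weight (r # x)) \<le> l_seq (Suc s)"
  shows "(\<Sum>x\<in>asc_chains r c. chain_weight (r # x)) < l_seq (Suc c)"
proof (cases "r = c")
  case True
  have "1 < m_seq (Suc c)" using assms l_seq_pos[of c] by (simp add: m_seq_Suc)
  also have "\<dots> \<le> m_seq (Suc c) ^ Suc c" by (rule self_le_power) (use calculation in auto)
  also have "\<dots> \<le> l_seq (Suc c)" using assms by (intro m_seq_power_le_l_seq) auto
  finally show ?thesis using True by (simp add: asc_chains_self)
next
  case False
  have *: "{y. y \<in> asc_chains r s \<and> y @ [c] \<in> asc_chains r c} = asc_chains r s" if "s < c" for s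
    using snoc_in_asc_chains that by blast
  have pos: "0 < m_seq (Suc c)" using assms by (simp add: m_seq_Suc)
  have "(\<Sum>x\<in>asc_chains r s. chain_weight (r # x)) < m_seq (Suc c)" if "s < c" for s
    using le[OF that] l_seq_less_m_seq[of "Suc s" c] that by simp
  from digits_bound[of c, OF this]
  have "(\<Sum>x\<in>asc_chains r c. chain_weight (r # x)) < m_seq (Suc c) * m_seq (Suc c) ^ c"
    using pos by (subst sum_chain_weight_last_step[OF False subset_refl]) (simp add: *)
  also have "\<dots> \<le> l_seq (Suc c)"
    using assms m_seq_power_le_l_seq[of "Suc c"] by simp
  finally show ?thesis .
qed

lemma sum_chain_weight_le: "(\<Sum>x\<in>asc_chains r c. chain_weight (r # x)) \<le> l_seq (Suc c)"
proof (induction c rule: less_induct)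
  case (less c)
  show ?case
  proof (cases "c = 0")
    case True
    then show ?thesis by (cases "r = 0") (auto simp: asc_chains_self asc_chains_greater)
  next
    case False
    then show ?thesis using sum_chain_weight_strict[of c r] less by force
  qed
qed

lemma sum_chain_weight_less_m_seq:
  assumes "A \<subseteq> asc_chains r s" "s < c"
  shows "(\<Sum>x\<in>A. chain_weight (r # x)) < m_seq (Suc c)"
proof -
  have "(\<Sum>x\<in>A. chain_weight (r # x)) \<le> (\<Sum>x\<in>asc_chains r s. chain_weight (r # x))"
    using assms finite_asc_chains by (intro sum_mono2) auto
  also have "\<dots> \<le> l_seq (Suc s)" by (rule sum_chain_weight_le)
  also have "\<dots> < m_seq (Suc c)" using assms by (intro l_seq_less_m_seq) auto
  finally show ?thesis .
qed

text \<open>Equal sums have equal digits in base \<open>m_seq (Suc c)\<close>. Each digit is again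
  such a sum, over chains ending at some \<open>s < c\<close>, so the induction hypothesis recovers
  the chains.\<close>

lemma chain_weight_sum_inj:
  assumes "A \<subseteq> asc_chains r c" "B \<subseteq> asc_chains r c"
    and "(\<Sum>x\<in>A. chain_weight (r # x)) = (\<Sum>x\<in>B. chain_weight (r # x))"
  shows "A = B"
  using assms
proof (induction c arbitrary: A B rule: less_induct)
  case (less c)
  show ?case
  proof (cases "r = c")
    case True
    then have "A \<subseteq> {[]}" "B \<subseteq> {[]}" using less.prems asc_chains_self by auto
    then show ?thesis using less.prems(3) by (auto simp: subset_singleton_iff)
  next
    case False
    define P where "P A s = {y. y \<in> asc_chains r s \<and> y @ [c] \<in> A}" for A s
    have P: "P A s \<subseteq> asc_chains r s" for A s by (auto simp: P_def)
    have sums: "(\<Sum>s<c. (\<Sum>y\<in>P A s. chain_weight (r # y)) * m_seq (Suc c) ^ s) =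
      (\<Sum>s<c. (\<Sum>y\<in>P B s. chain_weight (r # y)) * m_seq (Suc c) ^ s)"
    \<comment> \<open>For \<open>c = 0\<close> both numerals are empty; otherwise the positive
      factor \<open>m_seq (Suc c)\<close> cancels.\<close>
    proof (cases "c = 0")
      case False
      then have "0 < m_seq (Suc c)" by (simp add: m_seq_Suc)
      then show ?thesis
        using less.prems(3) sum_chain_weight_last_step[OF \<open>r \<noteq> c\<close> less.prems(1)]
          sum_chain_weight_last_step[OF \<open>r \<noteq> c\<close> less.prems(2)]
        unfolding P_def by simp
    qed simp
    have "P A s = P B s" if "s < c" for s
    proof (rule less.IH[OF that P P])
      show "(\<Sum>y\<in>P A s. chain_weight (r # y)) = (\<Sum>y\<in>P B s. chain_weight (r # y))"
        using digits_unique[OF _ _ sums that] sum_chain_weight_less_m_seq P by blast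
    qed
    then show ?thesis
      using less.prems(1,2) unfolding P_def asc_chains_decompose[OF False] by blast
  qed
qed

subsection \<open>Matrix entries\<close>

text \<open>Combinatorial counterpart of left multiplication by a generator: row \<open>p\<close>
  vanishes, and a row \<open>r < p\<close> gains a multiple of row \<open>p\<close>. The added
  chains are those whose embedding has to use the new letter \<open>p\<close>.\<close>

lemma fresh_chains_Cons:
  "fresh_chains (p # u) r c = (if r = p then {} else fresh_chains u r c \<union>
    (if r < p then Cons p ` fresh_chains u p c else {}))"
proof (cases "r = p")
  case True
  \<comment> \<open>All letters of \<open>x\<close> exceed \<open>p\<close>, so \<open>x\<close>
    already embeds into \<open>u\<close>, and then \<open>p # x\<close> embeds into
    \<open>p # u\<close>.\<close>
  have "subseq x u" if "subseq x (p # u)" "sorted_wrt (<) (p # x)" for x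
    using that by (cases x) (auto simp: subseq_Cons2_iff split: if_splits)
  with True show ?thesis by (auto simp: fresh_chains_def asc_chains_def)
next
  case False
  show ?thesis
  proof (intro equalityI subsetI)
    fix x assume "x \<in> fresh_chains (p # u) r c"
    then have x: "x \<in> asc_chains r c" "subseq x (p # u)" "\<not> subseq (r # x) u"
      using False by (auto simp: fresh_chains_def)
    show "x \<in> (if r = p then {} else fresh_chains u r c \<union>
        (if r < p then Cons p ` fresh_chains u p c else {}))"
    proof (cases "subseq x u")
      case True
      then show ?thesis using x False by (auto simp: fresh_chains_def)
    next
      case nx: False
      then obtain y where y: "x = p # y" "subseq y u"
        using x(2) by (cases x) (auto simp: subseq_Cons2_iff split: if_splits)
      then have "r < p" "y \<in> fresh_chains u p c"
        using x nx by (auto simp: fresh_chains_def asc_chains_def)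
      then show ?thesis using y False by auto
    qed
  next
    fix x assume "x \<in> (if r = p then {} else fresh_chains u r c \<union>
        (if r < p then Cons p ` fresh_chains u p c else {}))"
    then consider "x \<in> fresh_chains u r c" | y where "r < p" "x = p # y" "y \<in> fresh_chains u p c"
      using False by (auto split: if_splits)
    then show "x \<in> fresh_chains (p # u) r c"
    proof cases
      case 1
      then show ?thesis using False by (auto simp: fresh_chains_def)
    next
      case 2
      then have "\<not> subseq (r # p # y) u"
        using subseq_Cons'[of r "p # y" u] by (auto simp: fresh_chains_def)
      with 2 show ?thesis by (auto simp: fresh_chains_def asc_chains_def)
    qed
  qed
qed

lemma finite_fresh_chains: "finite (fresh_chains u r c)"
  using finite_asc_chains[of r c] by (rule finite_subset[rotated]) (auto simp: fresh_chains_def)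

lemma sum_fresh_chains_Cons:
  "(\<Sum>x\<in>fresh_chains (p # u) r c. chain_weight (r # x)) =
    (if r = p then 0 else (\<Sum>x\<in>fresh_chains u r c. chain_weight (r # x)) +
      (if r < p then m_seq (Suc p) ^ Suc r * (\<Sum>x\<in>fresh_chains u p c. chain_weight (p # x)) else 0))"
proof (cases "r < p")
  case True
  have "fresh_chains u r c \<inter> Cons p ` fresh_chains u p c = {}"
    by (auto simp: fresh_chains_def)
  then have "(\<Sum>x\<in>fresh_chains (p # u) r c. chain_weight (r # x)) =
      (\<Sum>x\<in>fresh_chains u r c. chain_weight (r # x)) +
      (\<Sum>x\<in>Cons p ` fresh_chains u p c. chain_weight (r # x))"
    using True by (simp add: fresh_chains_Cons finite_fresh_chains sum.union_disjoint)
  then show ?thesis using True by (simp add: sum.reindex sum_distrib_left)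
qed (auto simp: fresh_chains_Cons)


text \<open>Both sides obey the same recursion on \<open>u\<close>. The generator \<open>k\<close>
  modifies column \<open>n + 1 - k\<close>, which has index \<open>n - k\<close> when counting from
  \<open>0\<close>.\<close>

lemma poly_eval_kappa_word:
  assumes "u \<in> lists {1..n}" "r < n" "c < n"
  shows "poly_eval (\<lambda>(i, j). int (m_seq j) ^ i) (kappa_word n u $$ (r, c)) =
    int (\<Sum>x\<in>fresh_chains (map (\<lambda>k. n - k) u) r c. chain_weight (r # x))"
  using assms(1,2)
proof (induction u arbitrary: r rule: list.induct)
  case Nil
  have "fresh_chains [] r c = (if r = c then {[]} else {})"
    by (auto simp: fresh_chains_def asc_chains_def)
  then show ?case using Nil assms by (simp add: kappa_word_def)
next
  case (Cons k u)
  let ?e = "poly_eval (\<lambda>(i, j). int (m_seq j) ^ i)"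
  have k: "1 \<le> k" "k \<le> n" and u: "u \<in> lists {1..n}"
    using Cons.prems by (auto simp: in_lists_conv_set)
  define p where "p = n - k"
  have p: "n + 1 - k = Suc p" "p < n" using k by (auto simp: p_def)
  have "kappa_word n (k # u) $$ (r, c) =
      (if r = p then 0 else kappa_word n u $$ (r, c) +
        (if r < p then xi (Suc r) (Suc p) * kappa_word n u $$ (p, c) else 0))"
    using kappa_column_matrix_mult_index[OF kappa_word_carrier[of n u], of "Suc p" r c]
      Cons.prems assms(3) p by (simp add: kappa_word_def kappa_gen_def)
  then have "?e (kappa_word n (k # u) $$ (r, c)) =
      (if r = p then 0 else ?e (kappa_word n u $$ (r, c)) +
        (if r < p then int (m_seq (Suc p)) ^ Suc r * ?e (kappa_word n u $$ (p, c)) else 0))"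
    by (simp add: poly_eval_add poly_eval_mult poly_eval_xi)
  then show ?case
    using Cons.IH[OF u Cons.prems(2)] Cons.IH[OF u p(2)]
    by (simp add: sum_fresh_chains_Cons flip: p_def)
qed

section \<open>Recovering subsequences from the evaluated matrix\<close>

lemma kappa'_entry:
  assumes "u \<in> lists {1..n}" "r < n" "c < n"
  shows "kappa' n (kiselman_cong n `` {u}) $$ (r, c) =
    int (\<Sum>x\<in>fresh_chains (map (\<lambda>k. n - k) u) r c. chain_weight (r # x))"
  using poly_eval_kappa_word[OF assms] assms carrier_matD[OF kappa_word_carrier[of n u]]
  unfolding kappa'_def kappa_class[OF assms(1)] by simp

text \<open>For increasing \<open>r # x\<close>, this list embeds iff \<open>x\<close> does and
  \<open>x\<close> is not fresh from \<open>r\<close>. Thus embeddability is decided by adding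
  letters at the front.\<close>

lemma same_fresh_chains_imp_same_subseqs:
  assumes "\<And>r c. r < n \<Longrightarrow> c < n \<Longrightarrow> fresh_chains u r c = fresh_chains v r c"
    and "set u \<subseteq> {..<n}" "set v \<subseteq> {..<n}" "sorted_wrt (<) x"
  shows "subseq x u \<longleftrightarrow> subseq x v"
  using assms(4)
proof (induction x)
  case (Cons r x)
  show ?case
  proof (cases "set (r # x) \<subseteq> {..<n}")
    case True
    define c where "c = last (r # x)"
    have "c \<in> set (r # x)" unfolding c_def by (rule last_in_set) simp
    then have "r < n" "c < n" using True by auto
    then have "fresh_chains u r c = fresh_chains v r c" by (rule assms(1))
    moreover have "subseq (r # x) w \<longleftrightarrow> subseq x w \<and> x \<notin> fresh_chains w r c" for w
      using Cons.prems subseq_Cons'[of r x w] by (auto simp: fresh_chains_def asc_chains_def c_def)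
    ultimately show ?thesis using Cons by simp
  next
    case False
    then show ?thesis using assms(2,3) subseq_set_subset by blast
  qed
qed simp

lemma same_kappa'_imp_same_subseqs:
  assumes "u \<in> lists {1..n}" "v \<in> lists {1..n}"
    and eq: "kappa' n (kiselman_cong n `` {u}) = kappa' n (kiselman_cong n `` {v})"
    and z: "sorted_wrt (>) z"
  shows "subseq z u \<longleftrightarrow> subseq z v"
proof (cases "set z \<subseteq> {1..n}")
  case True
  let ?f = "map (\<lambda>k. n - k)"
  \<comment> \<open>The reflection reverses the order, turning decreasing sequences of generators
    into increasing chains of indices, and undoes itself here.\<close>
  have inv: "?f (?f w) = w" if "set w \<subseteq> {1..n}" for w
    using that by (auto intro!: map_idI)
  have subseq_f: "subseq (?f z) (?f w) \<longleftrightarrow> subseq z w" if "w \<in> lists {1..n}" for w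
    using subseq_map[of z w "\<lambda>k. n - k"] subseq_map[of "?f z" "?f w" "\<lambda>k. n - k"] inv[of z] inv[of w]
      True that by (auto simp: in_lists_conv_set subset_iff)
  have "subseq (?f z) (?f u) \<longleftrightarrow> subseq (?f z) (?f v)"
  proof (rule same_fresh_chains_imp_same_subseqs)
    fix r c assume rc: "r < n" "c < n"
    have "int (\<Sum>x\<in>fresh_chains (?f u) r c. chain_weight (r # x)) =
        int (\<Sum>x\<in>fresh_chains (?f v) r c. chain_weight (r # x))"
      using kappa'_entry[OF assms(1) rc] kappa'_entry[OF assms(2) rc] eq by metis
    then show "fresh_chains (?f u) r c = fresh_chains (?f v) r c"
      by (intro chain_weight_sum_inj[of _ r c]) (auto simp: fresh_chains_def simp flip: of_nat_sum)
  next
    show "set (?f u) \<subseteq> {..<n}" "set (?f v) \<subseteq> {..<n}"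
      using assms(1,2) by (auto simp: in_lists_conv_set)
    show "sorted_wrt (<) (?f z)"
      unfolding sorted_wrt_map using z
      by (rule sorted_wrt_mono_rel[rotated]) (use True in \<open>auto simp: subset_iff intro: diff_less_mono2\<close>)
  qed
  then show ?thesis using subseq_f assms by blast
next
  case False
  then show ?thesis
    using subseq_set_subset[of z u] subseq_set_subset[of z v] assms(1,2)
    by (simp add: in_lists_conv_set subset_iff) blast
qed

section \<open>Normal representatives, the entry bound and faithfulness\<close>

lemma kiselman_carrierE:
  assumes "w \<in> carrier (kiselman n)"
  obtains u where "u \<in> lists {1..n}" "normal_word u" "w = kiselman_cong n `` {u}"
proof -
  obtain u where u: "u \<in> lists {1..n}" "w = kiselman_cong n `` {u}"
    using assms by (auto simp: kiselman_def pres_monoid_def elim!: quotientE)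
  obtain v where v: "(u, v) \<in> kiselman_cong n" "normal_word v"
    using normal_word_exists[OF u(1)] by blast
  show ?thesis
    using that[of v] v u(2) pres_cong_lists[OF v(1)] equiv_class_eq[OF equiv_pres_cong v(1)] by blast
qed

text \<open>The last column needs the strict bound on the sum over all chains; in earlier columns an
  entry is even below \<open>m_seq n\<close>. The case \<open>n = 1\<close> is separate, as the unit
  attains \<open>l_seq 1\<close>.\<close>

lemma kappa'_entry_less:
  assumes "w \<in> carrier (kiselman n)" "n = 1 \<Longrightarrow> w \<noteq> \<one>\<^bsub>kiselman n\<^esub>" "r < n" "c < n"
  shows "kappa' n w $$ (r, c) < int (l_seq n)"
proof -
  obtain u where u: "u \<in> lists {1..n}" "w = kiselman_cong n `` {u}"
    using assms(1) by (rule kiselman_carrierE)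
  let ?F = "fresh_chains (map (\<lambda>k. n - k) u) r c"
  have entry: "kappa' n w $$ (r, c) = int (\<Sum>x\<in>?F. chain_weight (r # x))"
    using kappa'_entry u assms by simp
  have sub: "?F \<subseteq> asc_chains r c" by (auto simp: fresh_chains_def)
  show ?thesis
  proof (cases "n = 1")
    case True
    then have rc: "r = 0" "c = 0" using assms by auto
    have "u \<noteq> []" using assms(2) True u by (auto simp: kiselman_def pres_monoid_def)
    then have "0 \<in> set (map (\<lambda>k. n - k) u)" using u True by (cases u) auto
    \<comment> \<open>The only candidate is \<open>[]\<close>, and it is not fresh because the word
      contains the index \<open>0\<close>.\<close>
    then have "?F = {}"
      using asc_chains_self[of 0] rc by (auto simp: fresh_chains_def subseq_singleton_left)
    then show ?thesis using entry l_seq_pos[of n] by simp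
  next
    case False
    then have n: "2 \<le> n" using assms by auto
    show ?thesis
    proof (cases "Suc c = n")
      case True
      have "(\<Sum>x\<in>?F. chain_weight (r # x)) \<le> (\<Sum>x\<in>asc_chains r c. chain_weight (r # x))"
        using sub finite_asc_chains by (intro sum_mono2) auto
      also have "\<dots> < l_seq (Suc c)"
        using n True sum_chain_weight_le by (intro sum_chain_weight_strict) auto
      finally show ?thesis using entry True by (simp only: of_nat_less_iff)
    next
      case False
      have "(\<Sum>x\<in>?F. chain_weight (r # x)) < m_seq (Suc (n - 1))"
        using sub False assms by (intro sum_chain_weight_less_m_seq) auto
      also have "\<dots> \<le> m_seq n ^ n" using n self_le_power[of "m_seq n" n] by (simp add: m_seq_rec)
      also have "\<dots> \<le> l_seq n" using n by (rule m_seq_power_le_l_seq)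
      finally show ?thesis using entry by (simp only: of_nat_less_iff)
    qed
  qed
qed

theorem proposition35:
  fixes n :: nat
  assumes "1 \<le> n"
  shows "inj_on (kappa' n) (carrier (kiselman n)) \<and>
    (\<forall>w \<in> carrier (kiselman n). \<not> (n = 1 \<and> w = \<one>\<^bsub>kiselman n\<^esub>) \<longrightarrow>
      (\<forall>r < n. \<forall>c < n. kappa' n w $$ (r, c) < int (l_seq n)))"
proof (intro conjI inj_onI)
  fix w w' assume w: "w \<in> carrier (kiselman n)" and w': "w' \<in> carrier (kiselman n)"
    and eq: "kappa' n w = kappa' n w'"
  obtain u where u: "u \<in> lists {1..n}" "normal_word u" "w = kiselman_cong n `` {u}"
    using w by (rule kiselman_carrierE)
  obtain v where v: "v \<in> lists {1..n}" "normal_word v" "w' = kiselman_cong n `` {v}"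
    using w' by (rule kiselman_carrierE)
  have "u = v"
  proof (rule normal_word_eqI[OF u(2) v(2)])
    fix z :: "nat list" assume "sorted_wrt (>) z"
    with eq show "subseq z u \<longleftrightarrow> subseq z v"
      unfolding u(3) v(3) by (intro same_kappa'_imp_same_subseqs[OF u(1) v(1)])
  qed
  then show "w = w'" using u v by simp
qed (auto intro: kappa'_entry_less)

end
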